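(* Let $N\ge 2$, let $X\in\mathbb{R}^{N\times n_x}$, $U\in\mathbb{R}^{N\times n_u}$, $M\in\mathbb{R}^{(N-1)\times n_x}$ and let $\mu\in\mathbb{R}^{n_x}$ be a row vector. Define $\Lambda\in\mathbb{R}^{N\times n_x}$ by $\Lambda=W^{-1}\tilde A^{T}M$. Then $(X,U,M,\mu)$ satisfies the KKT conditions $$\mu=\mathbf 1^{T}M+\nabla_{X_1}\langle M,\tilde A_{(:,1)}F_1\rangle,$$ $$M=\nabla_{X_{2:N}}\langle M,\tilde A_{(:,2:N)}F_{2:N}\rangle+\tilde e_{N-1}\nabla\Phi(X_N),$$ $$0=\nabla_U\langle M,\tilde A F\rangle$$ of the integral-form nonlinear program if and only if $$\Lambda=\mathbf 1\Lambda_1+A^{\dagger}\Big[-\nabla_X\langle\Lambda,F\rangle+\frac{e_1}{w_1}(\mu-\Lambda_1)+\frac{e_N}{w_N}(\Lambda_N-\nabla\Phi(X_N))\Big]$$ and $$0=\nabla_U\langle\Lambda,F\rangle .$$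
   Context: Let $-1=\tau_1<\dots<\tau_N=1$ be the $N$ Legendre-Gauss-Lobatto (LGL) points, i.e. the roots of $(\tau^2-1)\dot P_{N-1}(\tau)$ with $P_{N-1}$ the Legendre polynomial of degree $N-1$; let $L_1,\dots,L_N$ be the Lagrange polynomials of degree $N-1$ supported at these points, $L_j(\tau_i)=\delta_{ij}$. The LGL quadrature weights are $w_j=\int_{-1}^{1}L_j(\tau)\,d\tau>0$, and $W=\mathrm{diag}(w_1,\dots,w_N)$. The matrix $A\in\mathbb{R}^{N\times N}$ has entries $A_{ij}=\int_{-1}^{\tau_i}L_j(\tau)\,d\tau$, and $\tilde A\in\mathbb{R}^{(N-1)\times N}$ is $A$ with its (zero) first row deleted; $\tilde A_{(:,1)}$ and $\tilde A_{(:,2:N)}$ are its first column and its remaining columns. The matrix $A^\dagger\in\mathbb{R}^{N\times N}$ is defined by $$A^\dagger_{ij}=w_j-\frac{w_j}{w_i}(1-\delta_{Ni})A_{ji},\qquad i,j=1,\dots,N.$$ Let $f:\mathbb{R}^{n_x}\times\mathbb{R}^{n_u}\to\mathbb{R}^{n_x}$ and $\Phi:\mathbb{R}^{n_x}\to\mathbb{R}$ be differentiable. For a matrix $Z$, $Z_i$ denotes its $i$-th row and $Z_{i:j}$ its rows $i$ through $j$. States and controls are row vectors: $X_i\in\mathbb{R}^{n_x}$, $U_i\in\mathbb{R}^{n_u}$, and $F\in\mathbb{R}^{N\times n_x}$ has rows $F_i=f(X_i,U_i)$. $\langle P,Q\rangle=\mathrm{tr}(P^TQ)$ is the Frobenius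 inner product. The gradient of a scalar function with respect to a matrix (or to some of its rows) is the matrix of the same shape of partial derivatives, where multipliers ($M$, $\Lambda$) are held constant; thus the $i$-th row of $\nabla_X\langle\Lambda,F\rangle$ is $\Lambda_i\,\partial f/\partial x(X_i,U_i)$. $\nabla\Phi$ is a row vector. $\mathbf 1$ is a column of ones of appropriate length, $e_1,e_N$ are the first and last columns of the $N\times N$ identity, and $\tilde e_{N-1}$ is the last column of the $(N-1)\times(N-1)$ identity $I_{N-1}$. The integral-form nonlinear program is: minimize $\Phi(X_N)$ over $X,U$ subject to $0=[\,\mathbf 1\;\;-I_{N-1}\,]X+\tilde A F$ and $X_1=x_0$ (with $x_0$ given). Its Lagrangian is $\Phi(X_N)+\langle M,[\,\mathbf 1\;\;-I_{N-1}\,]X+\tilde AF\rangle+\langle\mu,x_0-X_1\rangle$. *)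

theory Defs
  imports "HOL-Analysis.Analysis" "HOL-Computational_Algebra.Polynomial"
begin

(* Conventions: indices are 1-based.  A scalar matrix is a function nat => nat => real,
   and a matrix with n_x or n_u columns is a function from row indices to row vectors,
   nat => real^'n.  The row and column ranges are made explicit wherever such an object is
   used, so values outside the stated ranges never matter. *)

(* Rodrigues' formula *)
definition legendre_poly :: "nat \<Rightarrow> real poly" where
  "legendre_poly n = smult (1 / (2 ^ n * fact n)) ((pderiv ^^ n) ([:-1, 0, 1:] ^ n))"

definition lgl_points :: "nat \<Rightarrow> (nat \<Rightarrow> real) \<Rightarrow> bool" where
  "lgl_points N \<tau> \<longleftrightarrow>
     strict_mono_on {1..N} \<tau> \<and> \<tau> 1 = -1 \<and> \<tau> N = 1 \<and>
     \<tau> ` {1..N} = {x. poly ([:-1, 0, 1:] * pderiv (legendre_poly (N - 1))) x = 0}"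

definition lagrange_poly :: "nat \<Rightarrow> (nat \<Rightarrow> real) \<Rightarrow> nat \<Rightarrow> real poly" where
  "lagrange_poly N \<tau> j = (\<Prod>k\<in>{1..N} - {j}. smult (1 / (\<tau> j - \<tau> k)) [:- \<tau> k, 1:])"

definition lgl_weight :: "nat \<Rightarrow> (nat \<Rightarrow> real) \<Rightarrow> nat \<Rightarrow> real" where
  "lgl_weight N \<tau> j = integral {-1..1} (poly (lagrange_poly N \<tau> j))"

definition integ_mat :: "nat \<Rightarrow> (nat \<Rightarrow> real) \<Rightarrow> nat \<Rightarrow> nat \<Rightarrow> real" where
  "integ_mat N \<tau> i j = integral {-1..\<tau> i} (poly (lagrange_poly N \<tau> j))"

(* \<open>A\<close> with its first row deleted: rows 1..N-1, columns 1..N *)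
definition integ_mat_tilde :: "nat \<Rightarrow> (nat \<Rightarrow> real) \<Rightarrow> nat \<Rightarrow> nat \<Rightarrow> real" where
  "integ_mat_tilde N \<tau> k j = integ_mat N \<tau> (k + 1) j"

definition integ_mat_dagger :: "nat \<Rightarrow> (nat \<Rightarrow> real) \<Rightarrow> nat \<Rightarrow> nat \<Rightarrow> real" where
  "integ_mat_dagger N \<tau> i j =
     lgl_weight N \<tau> j -
     lgl_weight N \<tau> j / lgl_weight N \<tau> i * (1 - of_bool (N = i)) * integ_mat N \<tau> j i"

(* Product of the columns J of a scalar matrix with the rows J of Z *)
definition mat_prod :: "nat set \<Rightarrow> (nat \<Rightarrow> nat \<Rightarrow> real) \<Rightarrow> (nat \<Rightarrow> real ^ 'n) \<Rightarrow> nat \<Rightarrow> real ^ 'n" where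
  "mat_prod J B Z i = (\<Sum>j\<in>J. B i j *\<^sub>R Z j)"

(* tr(P^T Q) for matrices P and Q with row index set I *)
definition frob_inner :: "nat set \<Rightarrow> (nat \<Rightarrow> real ^ 'n) \<Rightarrow> (nat \<Rightarrow> real ^ 'n) \<Rightarrow> real" where
  "frob_inner I P Q = trace ((\<chi> k l. \<Sum>i\<in>I. P i $ k * Q i $ l) :: real ^ 'n ^ 'n)"

definition gradient :: "(real ^ 'n \<Rightarrow> real) \<Rightarrow> real ^ 'n \<Rightarrow> real ^ 'n" where
  "gradient g x = (\<chi> k. deriv (\<lambda>t. g (x + t *\<^sub>R axis k 1)) 0)"

(* Row i of the matrix of partial derivatives of g with respect to the entries of Z *)
definition mat_gradient ::
    "((nat \<Rightarrow> real ^ 'n) \<Rightarrow> real) \<Rightarrow> (nat \<Rightarrow> real ^ 'n) \<Rightarrow> nat \<Rightarrow> real ^ 'n" where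
  "mat_gradient g Z i = gradient (\<lambda>z. g (Z(i := z))) (Z i)"

definition dynamics ::
    "((real ^ 'nx) \<times> (real ^ 'nu) \<Rightarrow> real ^ 'nx) \<Rightarrow>
     (nat \<Rightarrow> real ^ 'nx) \<Rightarrow> (nat \<Rightarrow> real ^ 'nu) \<Rightarrow> nat \<Rightarrow> real ^ 'nx" where
  "dynamics f X U i = f (X i, U i)"

end

theory Submission imports Defs begin

text \<open>
  Put \<open>w\<^sub>i \<Lambda>\<^sub>i = \<Sum>\<^sub>k At\<^sub>k\<^sub>i M\<^sub>k\<close>.  Both Frobenius products are then separable in the nodes:
  \<open>\<langle>M, At F\<rangle> = \<Sum>\<^sub>j w\<^sub>j \<langle>\<Lambda>\<^sub>j, F\<^sub>j\<rangle>\<close>, so a gradient with respect to row \<open>i\<close> of one is \<open>w\<^sub>i\<close> times that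
  of the other (\<open>mat_gradient_separable\<close>).  With non-vanishing weights the control conditions agree
  at once, and with \<open>G\<^sub>i = \<nabla>\<^sub>x \<langle>\<Lambda>\<^sub>i, f(X\<^sub>i, U\<^sub>i)\<rangle>\<close> the state conditions say that the defects
  \<open>d\<^sub>j = M\<^sub>j\<^sub>-\<^sub>1 - w\<^sub>j G\<^sub>j - \<delta>\<^sub>j\<^sub>N \<nabla>\<Phi>(X\<^sub>N)\<close>, \<open>2 \<le> j \<le> N\<close>, and
  \<open>\<mu> - \<Sum>\<^sub>k M\<^sub>k - w\<^sub>1 G\<^sub>1\<close> all vanish.

  Row \<open>N\<close> of the costate equation says that the sum of all these defects is zero, because row \<open>N\<close>
  of \<open>A\<^sup>\<dagger>\<close> is the vector of weights.  Given that, and since the first row of \<open>A\<close> is zero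
  and its last row is \<open>w\<close>, row \<open>i < N\<close> says \<open>\<Sum>\<^sub>j A\<^sub>j\<^sub>i d\<^sub>j = 0\<close>, the sum running over \<open>2 \<le> j \<le> N\<close>.
  So the two systems are equivalent exactly because the block
  of \<open>A\<close> with rows \<open>2..N\<close> and columns \<open>1..N-1\<close> is regular (\<open>integral_costate_equivalence\<close>).

  Regularity (\<open>integ_mat_block_regular\<close>) is tested on polynomials: a combination of columns
  \<open>1..N-1\<close> with coefficients \<open>p(\<tau>\<^sub>i)\<close> gives the integrals of \<open>p\<close> up to the nodes, for any \<open>p\<close> of degree
  below \<open>N\<close> with \<open>p(1) = 0\<close>.  Taking \<open>p = Q'\<close>, where \<open>Q\<close> has a double root at \<open>1\<close> and simple
  roots at all other nodes except \<open>\<tau>\<^sub>k\<close>, isolates \<open>d\<^sub>k\<close> for \<open>k < N\<close>.  The remaining \<open>d\<^sub>N\<close> has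
  coefficient \<open>w\<^sub>1\<close> in the first equation.

  That no weight vanishes (\<open>lgl_weight_nonzero\<close>) is the one place where the nodes must be those of
  Legendre-Gauss-Lobatto.  Their nodal polynomial is orthogonal to all polynomials of degree below
  \<open>N - 2\<close>, so the quadrature is exact up to degree \<open>2N - 3\<close>; this is enough to
  express \<open>w\<^sub>j\<close>, up to a nonzero factor, as the integral of a polynomial of constant sign.
\<close>

section \<open>Integration by parts and orthogonality of Legendre polynomials\<close>

lemma integral_poly_pderiv:
  fixes p :: "real poly"
  assumes "a \<le> b"
  shows "integral {a..b} (poly (pderiv p)) = poly p b - poly p a"
proof (rule integral_unique, rule fundamental_theorem_of_calculus[OF assms])
  show "(poly p has_vector_derivative poly (pderiv p) x) (at x within {a..b})" for x
    using poly_DERIV[of p x] has_field_derivative_at_within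
    unfolding has_real_derivative_iff_has_vector_derivative[symmetric] by blast
qed

lemma poly_integrable: "poly (p :: real poly) integrable_on {a..b}"
  by (intro integrable_continuous_interval continuous_intros)

lemma integral_poly_add:
  "integral {a..b} (poly (p + q :: real poly)) = integral {a..b} (poly p) + integral {a..b} (poly q)"
proof -
  have "poly (p + q) = (\<lambda>x. poly p x + poly q x)" by (simp add: fun_eq_iff)
  then show ?thesis by (simp only: integral_add[OF poly_integrable poly_integrable])
qed

lemma integral_poly_0: "integral S (poly (0 :: real poly)) = 0"
proof -
  have "poly (0 :: real poly) = (\<lambda>x. 0)" by (simp add: fun_eq_iff)
  then show ?thesis by simp
qed

lemma integral_poly_smult:
  "integral {a..b} (poly (smult c p :: real poly)) = c * integral {a..b} (poly p)"
proof -
  have "poly (smult c p) = (\<lambda>x. c * poly p x)" by (simp add: fun_eq_iff)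
  then show ?thesis by (simp only: integral_mult_right)
qed

lemma integral_poly_parts:
  fixes p q :: "real poly"
  assumes "a \<le> b"
  shows "integral {a..b} (poly (pderiv p * q)) =
    poly p b * poly q b - poly p a * poly q a - integral {a..b} (poly (p * pderiv q))"
proof -
  have "pderiv (p * q) = pderiv p * q + p * pderiv q"
    by (simp add: pderiv_mult algebra_simps)
  then have "integral {a..b} (poly (pderiv p * q)) + integral {a..b} (poly (p * pderiv q)) =
      poly p b * poly q b - poly p a * poly q a"
    using integral_poly_pderiv[OF assms, of "p * q"]
    by (simp only: integral_poly_add poly_mult)
  then show ?thesis by linarith
qed

lemma power_dvd_pderiv:
  fixes p q :: "real poly"
  assumes "p ^ Suc m dvd q"
  shows "p ^ m dvd pderiv q"
proof -
  obtain r where "q = p ^ Suc m * r" using assms by (elim dvdE)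
  then have "pderiv q = p ^ m * (p * pderiv r + smult (of_nat (Suc m)) (pderiv p * r))"
    by (simp add: pderiv_mult pderiv_power_Suc algebra_simps del: power_Suc of_nat_Suc)
       (simp add: algebra_simps)
  then show ?thesis by simp
qed

lemma higher_pderiv_power_dvd:
  fixes p :: "real poly"
  assumes "k \<le> n"
  shows "p ^ (n - k) dvd (pderiv ^^ k) (p ^ n)"
  using assms
proof (induction k)
  case (Suc k)
  then have "p ^ Suc (n - Suc k) dvd (pderiv ^^ k) (p ^ n)"
    by (simp add: Suc_diff_Suc del: power_Suc)
  then show ?case using power_dvd_pderiv by simp
qed simp

text \<open>
  Repeated integration by parts: every boundary term vanishes because the lower derivatives of
  \<open>(t\<^sup>2 - 1)\<^sup>n\<close> still contain the factor \<open>t\<^sup>2 - 1\<close>.  The hypothesis on \<open>q\<close> is phrased through its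
  iterated derivative, which is the form that the induction passes on to \<open>pderiv q\<close>.
\<close>
lemma rodrigues_orthogonal:
  fixes q :: "real poly"
  assumes "(pderiv ^^ k) q = 0" "k \<le> n"
  shows "integral {-1..1} (poly ((pderiv ^^ k) ([:-1, 0, 1:] ^ n) * q)) = 0"
  using assms
proof (induction k arbitrary: q)
  case (Suc k)
  let ?D = "(pderiv ^^ k) ([:-1, 0, 1:] ^ n) :: real poly"
  have "[:-1, 0, 1:] ^ Suc (n - Suc k) dvd ?D"
    using higher_pderiv_power_dvd[of k n "[:-1, 0, 1:]"] Suc.prems
    by (simp add: Suc_diff_Suc del: power_Suc)
  then have "[:-1, 0, 1:] dvd ?D"
    by (rule dvd_trans[rotated]) (simp only: power_Suc dvd_triv_left)
  then have "poly ?D 1 = 0" "poly ?D (-1) = 0"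
    by (auto elim!: dvdE)
  moreover have "(pderiv ^^ k) (pderiv q) = 0"
    using Suc.prems(1) by (simp only: funpow_Suc_right o_apply)
  ultimately show ?case
    using integral_poly_parts[of "-1" 1 ?D q] Suc.IH[of "pderiv q"] Suc.prems(2)
    by (simp del: poly_mult)
next
  case 0
  then show ?case by (simp add: integral_poly_0)
qed

lemma higher_pderiv_eq_0:
  fixes q :: "real poly"
  assumes "degree q < n"
  shows "(pderiv ^^ n) q = 0"
proof -
  obtain m where n: "n = Suc m" using assms by (cases n) auto
  have "degree ((pderiv ^^ m) q) = 0"
    using assms n by (simp add: degree_higher_pderiv)
  then show ?thesis using n by (simp add: pderiv_eq_0_iff)
qed

lemma legendre_orthogonal:
  assumes "degree q < n"
  shows "integral {-1..1} (poly (legendre_poly n * q)) = 0"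
  using rodrigues_orthogonal[OF higher_pderiv_eq_0[OF assms] order_refl]
  by (simp only: legendre_poly_def mult_smult_left integral_poly_smult mult_zero_right)

lemma degree_legendre_le: "degree (legendre_poly n) \<le> n"
proof -
  have "degree ([:-1, 0, 1:] ^ n :: real poly) \<le> 2 * n"
    using degree_power_le[of "[:-1, 0, 1:] :: real poly" n] by (simp add: numeral_2_eq_2)
  then show ?thesis
    unfolding legendre_poly_def
    by (intro order.trans[OF degree_smult_le]) (simp add: degree_higher_pderiv)
qed

section \<open>The nodal polynomial\<close>

definition node_poly :: "(nat \<Rightarrow> real) \<Rightarrow> nat set \<Rightarrow> real poly" where
  "node_poly \<tau> S = (\<Prod>k\<in>S. [:- \<tau> k, 1:])"

lemma poly_node_poly: "poly (node_poly \<tau> S) x = (\<Prod>k\<in>S. x - \<tau> k)"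
  by (simp add: node_poly_def poly_prod)

lemma degree_node_poly: "degree (node_poly \<tau> S) = card S"
  unfolding node_poly_def by (subst degree_prod_eq_sum_degree) auto

lemma monic_node_poly: "lead_coeff (node_poly \<tau> S) = 1"
  unfolding node_poly_def lead_coeff_prod by simp

lemma node_poly_nz: "node_poly \<tau> S \<noteq> 0"
  using monic_node_poly[of \<tau> S] by auto

lemma node_poly_remove:
  "finite S \<Longrightarrow> k \<in> S \<Longrightarrow> node_poly \<tau> S = [:- \<tau> k, 1:] * node_poly \<tau> (S - {k})"
  unfolding node_poly_def by (rule prod.remove)

lemma node_poly_dvd:
  assumes "finite S" "inj_on \<tau> S" "\<And>k. k \<in> S \<Longrightarrow> poly p (\<tau> k) = 0"
  shows "node_poly \<tau> S dvd p"
  using assms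
proof (induction S arbitrary: p rule: finite_induct)
  case (insert k S)
  then obtain q where q: "p = [:- \<tau> k, 1:] * q"
    by (metis dvdE insertI1 poly_eq_0_iff_dvd)
  have "poly q (\<tau> l) = 0" if "l \<in> S" for l
    using insert.prems(2)[of l] insert.prems(1) insert.hyps(2) that q
    by (auto simp del: mult_pCons_left) (metis image_eqI)
  then have "node_poly \<tau> S dvd q" using insert by simp
  then show ?case
    using insert.hyps unfolding q node_poly_def by (simp add: mult_dvd_mono del: mult_pCons_left)
qed (simp add: node_poly_def)

lemma lgl_points_inj:
  "lgl_points N \<tau> \<Longrightarrow> inj_on \<tau> {1..N}"
  by (simp add: lgl_points_def strict_mono_on_imp_inj_on)

lemma lgl_points_range:
  assumes "lgl_points N \<tau>" "k \<in> {1..N}"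
  shows "-1 \<le> \<tau> k" "\<tau> k \<le> 1"
proof -
  have m: "mono_on {1..N} \<tau>" and e: "\<tau> 1 = -1" "\<tau> N = 1"
    using assms(1) by (auto simp: lgl_points_def strict_mono_on_imp_mono_on)
  show "-1 \<le> \<tau> k" "\<tau> k \<le> 1"
    using mono_onD[OF m, of 1 k] mono_onD[OF m, of k N] assms(2) e by auto
qed

text \<open>
  The \<open>N\<close> nodes are all the roots of \<open>(t\<^sup>2 - 1) P'\<^sub>N\<^sub>-\<^sub>1\<close>, whose degree is at most \<open>N\<close>; this polynomial
  is nonzero because its root set is finite.
\<close>
lemma lgl_node_poly:
  assumes "lgl_points N \<tau>" "N \<ge> 2"
  obtains c where
    "node_poly \<tau> {1..N} = smult c ([:-1, 0, 1:] * pderiv (legendre_poly (N - 1)))"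
proof -
  let ?R = "[:-1, 0, 1:] * pderiv (legendre_poly (N - 1))"
  have img: "\<tau> ` {1..N} = {x. poly ?R x = 0}"
    using assms(1) by (simp only: lgl_points_def)
  have "?R \<noteq> 0"
  proof
    assume "?R = 0"
    then have "\<tau> ` {1..N} = UNIV" unfolding img by simp
    then show False
      by (metis finite_atLeastAtMost finite_imageI infinite_UNIV_char_0)
  qed
  have "degree ?R \<le> 2 + (N - 2)"
    by (intro order.trans[OF degree_mult_le] add_mono)
       (use degree_legendre_le[of "N - 1"] assms(2) in \<open>auto simp: degree_pderiv\<close>)
  then have deg: "degree ?R \<le> N" using assms(2) by simp
  have "node_poly \<tau> {1..N} dvd ?R"
    using img lgl_points_inj[OF assms(1)] by (intro node_poly_dvd) auto
  then obtain s where s: "?R = node_poly \<tau> {1..N} * s" by (elim dvdE)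
  then have "s \<noteq> 0" using \<open>?R \<noteq> 0\<close> by auto
  then have "degree s = 0"
    using deg unfolding s by (simp add: degree_mult_eq node_poly_nz degree_node_poly)
  then obtain a where "s = [:a:]" using degree_eq_zeroE by blast
  with \<open>s \<noteq> 0\<close> s have "node_poly \<tau> {1..N} = smult (inverse a) ?R"
    by (simp del: mult_pCons_left)
  then show ?thesis using that by blast
qed

text \<open>
  One integration by parts turns \<open>(t\<^sup>2 - 1) P'\<^sub>N\<^sub>-\<^sub>1 s\<close> into \<open>- P\<^sub>N\<^sub>-\<^sub>1 ((t\<^sup>2 - 1) s)'\<close>, and the second factor
  has degree below \<open>N - 1\<close>.
\<close>
lemma lgl_node_poly_orthogonal:
  assumes "lgl_points N \<tau>" "N \<ge> 2" "degree s + 2 < N"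
  shows "integral {-1..1} (poly (node_poly \<tau> {1..N} * s)) = 0"
proof -
  obtain c where c: "node_poly \<tau> {1..N} = smult c ([:-1, 0, 1:] * pderiv (legendre_poly (N - 1)))"
    using lgl_node_poly[OF assms(1,2)] by blast
  let ?q = "[:-1, 0, 1:] * s"
  have "degree ?q \<le> 2 + degree s"
    by (intro order.trans[OF degree_mult_le]) simp
  then have "degree (pderiv ?q) < N - 1"
    using assms(3) unfolding degree_pderiv by linarith
  then have "integral {-1..1} (poly (pderiv (legendre_poly (N - 1)) * ?q)) = 0"
    using integral_poly_parts[of "-1" 1 "legendre_poly (N - 1)" ?q] legendre_orthogonal
    by simp
  moreover have "node_poly \<tau> {1..N} * s = smult c (pderiv (legendre_poly (N - 1)) * ?q)"
    unfolding c by (simp only: mult_smult_left mult_smult_right mult_ac)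
  ultimately show ?thesis by (simp only: integral_poly_smult mult_zero_right)
qed

section \<open>Lagrange interpolation and the quadrature weights\<close>

lemma lagrange_poly_node_poly:
  "lagrange_poly N \<tau> j =
     smult (\<Prod>k\<in>{1..N}-{j}. 1 / (\<tau> j - \<tau> k)) (node_poly \<tau> ({1..N} - {j}))"
  unfolding lagrange_poly_def node_poly_def by (rule prod_smult)

lemma poly_lagrange_poly:
  assumes "inj_on \<tau> {1..N}" "i \<in> {1..N}" "j \<in> {1..N}"
  shows "poly (lagrange_poly N \<tau> j) (\<tau> i) = of_bool (i = j)"
proof (cases "i = j")
  case True
  have "\<tau> j - \<tau> k \<noteq> 0" if "k \<in> {1..N} - {j}" for k
    using assms that by (auto dest: inj_onD)
  then show ?thesis using True
    by (simp add: lagrange_poly_node_poly poly_node_poly prod_dividef)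
next
  case False
  then have "(\<Prod>k\<in>{1..N}-{j}. \<tau> i - \<tau> k) = 0"
    using assms by (intro prod_zero) auto
  then show ?thesis using False by (simp add: lagrange_poly_node_poly poly_node_poly)
qed

lemma degree_lagrange_poly: "j \<in> {1..N} \<Longrightarrow> degree (lagrange_poly N \<tau> j) \<le> N - 1"
  unfolding lagrange_poly_node_poly
  by (intro order.trans[OF degree_smult_le]) (simp add: degree_node_poly)

lemma lagrange_expansion:
  fixes p :: "real poly"
  assumes "inj_on \<tau> {1..N}" "degree p < N"
  shows "p = (\<Sum>i\<in>{1..N}. smult (poly p (\<tau> i)) (lagrange_poly N \<tau> i))"
proof (rule poly_eqI_degree[where A = "\<tau> ` {1..N}"])
  fix x assume "x \<in> \<tau> ` {1..N}"
  then obtain j where j: "j \<in> {1..N}" "x = \<tau> j" by blast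
  have "poly (\<Sum>i\<in>{1..N}. smult (poly p (\<tau> i)) (lagrange_poly N \<tau> i)) x =
      (\<Sum>i\<in>{1..N}. poly p (\<tau> i) * of_bool (j = i))"
    unfolding poly_sum using j assms(1)
    by (intro sum.cong) (simp_all add: poly_lagrange_poly)
  also have "\<dots> = poly p x"
    using j by (simp add: of_bool_def if_distrib sum.delta' cong: if_cong)
  finally show "poly p x = poly (\<Sum>i\<in>{1..N}. smult (poly p (\<tau> i)) (lagrange_poly N \<tau> i)) x" ..
next
  have "degree (\<Sum>i\<in>{1..N}. smult (poly p (\<tau> i)) (lagrange_poly N \<tau> i)) \<le> N - 1"
    by (intro degree_sum_le order.trans[OF degree_smult_le] degree_lagrange_poly) auto
  then show "degree (\<Sum>i\<in>{1..N}. smult (poly p (\<tau> i)) (lagrange_poly N \<tau> i)) < card (\<tau> ` {1..N})"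
    using assms by (simp add: card_image)
qed (use assms in \<open>simp add: card_image\<close>)

lemma integ_mat_interpolates:
  fixes p :: "real poly"
  assumes "inj_on \<tau> {1..N}" "degree p < N"
  shows "(\<Sum>i\<in>{1..N}. poly p (\<tau> i) * integ_mat N \<tau> j i) = integral {-1..\<tau> j} (poly p)"
proof -
  have "integral {-1..\<tau> j} (poly p) =
      integral {-1..\<tau> j} (\<lambda>x. \<Sum>i\<in>{1..N}. poly (smult (poly p (\<tau> i)) (lagrange_poly N \<tau> i)) x)"
    by (subst lagrange_expansion[OF assms]) (rule arg_cong[where f = "integral _"], rule ext, rule poly_sum)
  also have "\<dots> = (\<Sum>i\<in>{1..N}. poly p (\<tau> i) * integ_mat N \<tau> j i)"
    unfolding integ_mat_def
    by (subst integral_sum) (auto simp: integral_poly_smult simp del: poly_smult intro: poly_integrable)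
  finally show ?thesis ..
qed

text \<open>
  Let \<open>h\<close> be the nodal polynomial of the interior nodes other than \<open>\<tau>\<^sub>j\<close>.  Then \<open>L\<^sub>j (h - h(\<tau>\<^sub>j))\<close>
  vanishes at all nodes and has degree at most \<open>2N - 3\<close>, so its integral is zero and
  \<open>h(\<tau>\<^sub>j) w\<^sub>j\<close> is the integral of \<open>L\<^sub>j h\<close>.  Up to a constant, \<open>L\<^sub>j h\<close> is \<open>h\<^sup>2 e\<close>, where \<open>e\<close> collects
  the factors of the endpoints other than \<open>\<tau>\<^sub>j\<close> and has constant sign on the interval.  A zero
  weight would force this nonzero polynomial to vanish on an interval.
\<close>
lemma lgl_weight_nonzero:
  assumes "lgl_points N \<tau>" "N \<ge> 2" "j \<in> {1..N}"
  shows "lgl_weight N \<tau> j \<noteq> 0"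
proof
  assume w0: "lgl_weight N \<tau> j = 0"
  note inj = lgl_points_inj[OF assms(1)]
  have ends: "\<tau> 1 = -1" "\<tau> N = 1" using assms(1) by (auto simp: lgl_points_def)
  define h where "h = node_poly \<tau> ({1..N} - {j, 1, N})"
  define e where "e = node_poly \<tau> ({1, N} - {j})"
  define L where "L = lagrange_poly N \<tau> j"
  define s0 where "s0 = L * (h - [:poly h (\<tau> j):])"
  have degh: "degree h \<le> N - 2"
  proof -
    have "card ({1..N} - {j, 1, N}) \<le> card ({1..N} - {1, N})"
      by (intro card_mono) auto
    also have "\<dots> = N - 2" using assms(2) by (subst card_Diff_subset) auto
    finally show ?thesis by (simp add: h_def degree_node_poly)
  qed
  have "node_poly \<tau> {1..N} dvd s0"
    using assms(3) inj unfolding s0_def L_def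
    by (intro node_poly_dvd) (auto simp: poly_lagrange_poly)
  then obtain s where s: "s0 = node_poly \<tau> {1..N} * s" by (elim dvdE)
  have "integral {-1..1} (poly s0) = 0"
  proof (cases "s = 0")
    case False
    have "N + degree s = degree s0"
      unfolding s using False by (simp add: degree_mult_eq node_poly_nz degree_node_poly)
    also have "degree s0 \<le> (N - 1) + (N - 2)"
      unfolding s0_def L_def using degh assms(3)
      by (intro order.trans[OF degree_mult_le] add_mono degree_lagrange_poly degree_diff_le) auto
    finally have "degree s + 2 < N" using assms(2) by linarith
    then show ?thesis unfolding s by (rule lgl_node_poly_orthogonal[OF assms(1,2)])
  qed (simp add: s integral_poly_0)
  moreover have "L * h = s0 + smult (poly h (\<tau> j)) L"
    by (simp add: s0_def algebra_simps)
  ultimately have Lh: "integral {-1..1} (poly (L * h)) = 0"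
    using w0 by (simp only: integral_poly_add integral_poly_smult L_def lgl_weight_def)
  define c where "c = (\<Prod>k\<in>{1..N}-{j}. 1 / (\<tau> j - \<tau> k))"
  have "c \<noteq> 0"
    using inj assms(3) unfolding c_def by (auto dest: inj_onD)
  have "node_poly \<tau> ({1..N} - {j}) = h * e"
    unfolding h_def e_def node_poly_def using assms(2)
    by (subst prod.union_disjoint[symmetric]) (auto intro!: prod.cong)
  then have "L * h = smult c (h * h * e)"
    unfolding L_def lagrange_poly_node_poly c_def by (simp add: mult_ac)
  with Lh \<open>c \<noteq> 0\<close> have int0: "integral {-1..1} (poly (h * h * e)) = 0"
    by (simp only: integral_poly_smult mult_eq_0_iff) simp
  have "(\<forall>x\<in>{-1..1}. poly e x \<ge> 0) \<or> (\<forall>x\<in>{-1..1}. poly e x \<le> 0)"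
  proof -
    consider "j = 1" | "j = N" | "j \<noteq> 1" "j \<noteq> N" by blast
    then show ?thesis
    proof cases
      case 1
      then have "{1, N} - {j} = {N}" using assms(2) by auto
      then show ?thesis by (simp add: e_def poly_node_poly ends)
    next
      case 2
      then have "{1, N} - {j} = {1}" using assms(2) by auto
      then have "poly e x = x + 1" for x
        by (simp add: e_def poly_node_poly ends(1)[simplified])
      then show ?thesis by auto
    next
      case 3
      then have "{1, N} - {j} = {1, N}" by auto
      then have "poly e x = (x + 1) * (x - 1)" for x
        using assms(2) by (simp add: e_def poly_node_poly ends(2) ends(1)[simplified])
      then show ?thesis by (auto intro!: mult_nonneg_nonpos)
    qed
  qed
  then obtain \<sigma> :: real where \<sigma>: "\<sigma> \<noteq> 0" "\<forall>x\<in>{-1..1}. \<sigma> * poly e x \<ge> 0"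
    by (elim disjE) (auto intro: that[of 1] that[of "-1"])
  let ?g = "smult \<sigma> (h * h * e)"
  have "integral {-1..1} (poly ?g) = 0"
    by (simp only: integral_poly_smult int0 mult_zero_right)
  moreover have "poly ?g x \<ge> 0" if "x \<in> {-1..1}" for x
  proof -
    have "poly ?g x = (poly h x * poly h x) * (\<sigma> * poly e x)" by simp
    then show ?thesis using \<sigma>(2) that by (metis mult_nonneg_nonneg zero_le_square)
  qed
  ultimately have "\<forall>x\<in>{-1..1}. poly ?g x = 0"
    using integral_eq_0_iff[of "-1" 1 "poly ?g", OF continuous_on_poly[OF continuous_on_id]]
    by simp
  then have "{-1..1} \<subseteq> {x. poly ?g x = 0}" by blast
  moreover have "?g \<noteq> 0" using \<sigma>(1) by (simp add: h_def e_def node_poly_nz)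
  ultimately have "finite {-1..1::real}"
    using poly_roots_finite finite_subset by blast
  then show False by (simp add: infinite_Icc)
qed

section \<open>Regularity of the integration matrix\<close>

lemma integ_mat_first_row: "\<tau> 1 = -1 \<Longrightarrow> integ_mat N \<tau> 1 i = 0"
  by (simp add: integ_mat_def)

lemma integ_mat_last_row: "\<tau> N = 1 \<Longrightarrow> integ_mat N \<tau> N i = lgl_weight N \<tau> i"
  by (simp add: integ_mat_def lgl_weight_def)

text \<open>
  The equations are combined with the coefficients \<open>Q'(\<tau>\<^sub>i)\<close>, where \<open>Q = (t - 1) \<Prod>\<^sub>l\<^sub>\<noteq>\<^sub>k (t - \<tau>\<^sub>l)\<close>.  The
  double root at \<open>1\<close> makes \<open>Q'\<close> vanish there, so that the absent column \<open>N\<close> contributes nothing,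
  and the combination collapses to \<open>Q(\<tau>\<^sub>k) d\<^sub>k = 0\<close>.  The last node is not reached in this way,
  but it is the only unknown left.
\<close>
lemma integ_mat_block_regular:
  fixes d :: "nat \<Rightarrow> 'v::real_vector"
  assumes "lgl_points N \<tau>" "N \<ge> 2"
    and ker: "\<And>i. i \<in> {1..N-1} \<Longrightarrow> (\<Sum>j\<in>{2..N}. integ_mat N \<tau> j i *\<^sub>R d j) = 0"
    and "k \<in> {2..N}"
  shows "d k = 0"
proof -
  note inj = lgl_points_inj[OF assms(1)]
  have ends: "\<tau> 1 = -1" "\<tau> N = 1" using assms(1) by (auto simp: lgl_points_def)
  have interior: "d k = 0" if k: "k \<in> {2..N-1}" for k
  proof -
    define R where "R = node_poly \<tau> ({1..N} - {k})"
    define Q where "Q = [:-1, 1:] * R"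
    have RN: "poly R (\<tau> l) = 0 \<longleftrightarrow> l \<noteq> k" if "l \<in> {1..N}" for l
      using that k inj by (auto simp: R_def poly_node_poly dest: inj_onD)
    have "degree Q = N"
      unfolding Q_def using k
      by (subst degree_mult_eq) (auto simp: R_def node_poly_nz degree_node_poly)
    then have deg: "degree (pderiv Q) < N" using assms(2) by (simp add: degree_pderiv)
    have "poly R 1 = 0" using RN[of N] k ends by auto
    then have Q1: "poly (pderiv Q) (\<tau> N) = 0"
      unfolding Q_def by (simp add: pderiv_mult pderiv_pCons ends del: mult_pCons_left)
    have Q0: "poly Q (-1) = 0" using RN[of 1] k ends by (auto simp: Q_def)
    have moment: "(\<Sum>i\<in>{1..N-1}. poly (pderiv Q) (\<tau> i) * integ_mat N \<tau> j i) = poly Q (\<tau> j)"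
      if "j \<in> {2..N}" for j
    proof -
      have "{1..N} = insert N {1..N-1}" using assms(2) by auto
      then have "(\<Sum>i\<in>{1..N-1}. poly (pderiv Q) (\<tau> i) * integ_mat N \<tau> j i) =
          (\<Sum>i\<in>{1..N}. poly (pderiv Q) (\<tau> i) * integ_mat N \<tau> j i)"
        using Q1 assms(2) by simp
      also have "\<dots> = poly Q (\<tau> j)"
        using integ_mat_interpolates[OF inj deg] lgl_points_range[OF assms(1)] that Q0
        by (simp add: integral_poly_pderiv)
      finally show ?thesis .
    qed
    have "0 = (\<Sum>i\<in>{1..N-1}. poly (pderiv Q) (\<tau> i) *\<^sub>R (\<Sum>j\<in>{2..N}. integ_mat N \<tau> j i *\<^sub>R d j))"
      using ker by simp
    also have "\<dots> = (\<Sum>j\<in>{2..N}. poly Q (\<tau> j) *\<^sub>R d j)"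
      unfolding scaleR_sum_right scaleR_scaleR
      by (subst sum.swap) (auto simp: moment[symmetric] scaleR_sum_left intro!: sum.cong)
    also have "\<dots> = (\<Sum>j\<in>{k}. poly Q (\<tau> j) *\<^sub>R d j)"
      using k RN by (intro sum.mono_neutral_right) (auto simp: Q_def)
    finally have "poly Q (\<tau> k) *\<^sub>R d k = 0" by simp
    moreover have "\<tau> k \<noteq> 1" using inj k ends by (auto dest: inj_onD[of _ _ k N])
    then have "poly Q (\<tau> k) \<noteq> 0"
      using RN[of k] k by (simp add: Q_def algebra_simps) linarith
    ultimately show ?thesis by simp
  qed
  have "(\<Sum>j\<in>{2..N}. integ_mat N \<tau> j 1 *\<^sub>R d j) = (\<Sum>j\<in>{N}. integ_mat N \<tau> j 1 *\<^sub>R d j)"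
    using assms(2) interior by (intro sum.mono_neutral_right) auto
  then have "lgl_weight N \<tau> 1 *\<^sub>R d N = 0"
    using ker[of 1] assms(2) integ_mat_last_row[of \<tau> N, OF ends(2)] by simp
  then have "d N = 0" using lgl_weight_nonzero[OF assms(1,2), of 1] assms(2) by simp
  then show ?thesis using interior[of k] assms(4) by (cases "k = N") auto
qed


section \<open>Gradients of separable functions\<close>

lemma frob_inner_eq: "frob_inner I P Q = (\<Sum>i\<in>I. P i \<bullet> Q i)"
  unfolding frob_inner_def trace_def inner_vec_def
  by (simp add: sum.swap[of _ I])

lemma frob_inner_mat_prod:
  "frob_inner I M (mat_prod J B Z) = (\<Sum>j\<in>J. (\<Sum>k\<in>I. B k j *\<^sub>R M k) \<bullet> Z j)"
  unfolding frob_inner_eq mat_prod_def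
  by (simp add: inner_sum_right inner_sum_left sum.swap[of _ I])

text \<open>
  Only the summand of row \<open>i\<close> varies.  Its factor \<open>a i\<close> can be taken out of \<open>deriv\<close> because the
  derivative exists; elsewhere the value of \<open>deriv\<close> is an arbitrary choice.
\<close>
lemma mat_gradient_separable:
  fixes Z :: "nat \<Rightarrow> real ^ 'm"
  assumes "finite J" "i \<in> J" and diff: "\<phi> i differentiable (at (Z i))"
  shows "mat_gradient (\<lambda>Y. \<Sum>j\<in>J. a j * \<phi> j (Y j)) Z i = a i *\<^sub>R gradient (\<phi> i) (Z i)"
proof -
  define c where "c = (\<Sum>j\<in>J - {i}. a j * \<phi> j (Z j))"
  have split: "(\<Sum>j\<in>J. a j * \<phi> j ((Z(i := z)) j)) = a i * \<phi> i z + c" for z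
    unfolding c_def using assms(1,2) by (subst sum.remove[of J i]) auto
  have "deriv (\<lambda>t. a i * \<phi> i (Z i + t *\<^sub>R axis k 1) + c) 0 =
      a i * deriv (\<lambda>t. \<phi> i (Z i + t *\<^sub>R axis k 1)) 0" for k
  proof -
    have "(\<lambda>t::real. \<phi> i (Z i + t *\<^sub>R axis k 1)) differentiable (at 0)"
      by (rule differentiable_compose[where f = "\<phi> i"]) (use diff in \<open>auto intro!: derivative_intros\<close>)
    then have "((\<lambda>t. \<phi> i (Z i + t *\<^sub>R axis k 1)) has_field_derivative
        deriv (\<lambda>t. \<phi> i (Z i + t *\<^sub>R axis k 1)) 0) (at 0)"
      using DERIV_deriv_iff_real_differentiable by blast
    then show ?thesis
      by (intro DERIV_imp_deriv) (auto intro!: derivative_eq_intros)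
  qed
  then show ?thesis
    unfolding mat_gradient_def gradient_def split by (simp add: vec_eq_iff)
qed

section \<open>Equivalence of the multiplier equations\<close>

text \<open>
  The linear algebra behind the theorem, for any weights and integration matrix with the stated
  first row, last row and regular block.  Here \<open>G\<close> stands for the rows of the gradient of
  \<open>\<langle>\<Lambda>, F\<rangle>\<close> and \<open>\<phi>\<close> for the gradient of the terminal cost.
\<close>
lemma integral_costate_equivalence:
  fixes \<Lambda> G M :: "nat \<Rightarrow> 'v::real_vector" and \<mu> \<phi> :: 'v
    and w :: "nat \<Rightarrow> real" and A :: "nat \<Rightarrow> nat \<Rightarrow> real"
  assumes N: "N \<ge> 2"
    and w: "\<And>i. i \<in> {1..N} \<Longrightarrow> w i \<noteq> 0"
    and first: "\<And>i. i \<in> {1..N} \<Longrightarrow> A 1 i = 0"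
    and last: "\<And>i. i \<in> {1..N} \<Longrightarrow> A N i = w i"
    and regular: "\<And>(d :: nat \<Rightarrow> 'v) k. (\<And>i. i \<in> {1..N-1} \<Longrightarrow> (\<Sum>j\<in>{2..N}. A j i *\<^sub>R d j) = 0) \<Longrightarrow>
        k \<in> {2..N} \<Longrightarrow> d k = 0"
    and \<Lambda>: "\<And>i. i \<in> {1..N} \<Longrightarrow> w i *\<^sub>R \<Lambda> i = (\<Sum>j\<in>{2..N}. A j i *\<^sub>R M (j - 1))"
  shows "(\<mu> = (\<Sum>k\<in>{1..N-1}. M k) + w 1 *\<^sub>R G 1 \<and>
          (\<forall>k\<in>{1..N-1}. M k = w (k + 1) *\<^sub>R G (k + 1) + of_bool (k = N - 1) *\<^sub>R \<phi>)) \<longleftrightarrow>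
     (\<forall>i\<in>{1..N}. \<Lambda> i = \<Lambda> 1 + (\<Sum>j\<in>{1..N}.
        (w j - w j / w i * (1 - of_bool (N = i)) * A j i) *\<^sub>R
          (- G j + (of_bool (j = 1) / w 1) *\<^sub>R (\<mu> - \<Lambda> 1)
                 + (of_bool (j = N) / w N) *\<^sub>R (\<Lambda> N - \<phi>))))"
    (is "?kkt \<longleftrightarrow> ?costate")
proof -
  \<comment> \<open>The bracket in the costate equation, scaled by the weight so that no division is left.\<close>
  define r where "r j = - (w j *\<^sub>R G j) + of_bool (j = 1) *\<^sub>R (\<mu> - \<Lambda> 1)
      + of_bool (j = N) *\<^sub>R (\<Lambda> N - \<phi>)" for j
  \<comment> \<open>The defect of the stationarity condition for state \<open>j\<close>.\<close>
  define d where "d j = M (j - 1) - w j *\<^sub>R G j - of_bool (j = N) *\<^sub>R \<phi>" for j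
  have dagger: "(\<Sum>j\<in>{1..N}. (w j - w j / w i * (1 - of_bool (N = i)) * A j i) *\<^sub>R
          (- G j + (of_bool (j = 1) / w 1) *\<^sub>R (\<mu> - \<Lambda> 1)
                 + (of_bool (j = N) / w N) *\<^sub>R (\<Lambda> N - \<phi>)))
     = (\<Sum>j\<in>{1..N}. r j) - ((1 - of_bool (N = i)) / w i) *\<^sub>R (\<Sum>j\<in>{2..N}. A j i *\<^sub>R r j)"
    if i: "i \<in> {1..N}" for i
  proof -
    have "(\<Sum>j\<in>{1..N}. (w j - w j / w i * (1 - of_bool (N = i)) * A j i) *\<^sub>R
          (- G j + (of_bool (j = 1) / w 1) *\<^sub>R (\<mu> - \<Lambda> 1)
                 + (of_bool (j = N) / w N) *\<^sub>R (\<Lambda> N - \<phi>)))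
       = (\<Sum>j\<in>{1..N}. r j - ((1 - of_bool (N = i)) / w i) *\<^sub>R (A j i *\<^sub>R r j))"
    proof (rule sum.cong)
      fix j assume j: "j \<in> {1..N}"
      have "r j = w j *\<^sub>R (- G j + (of_bool (j = 1) / w 1) *\<^sub>R (\<mu> - \<Lambda> 1)
                 + (of_bool (j = N) / w N) *\<^sub>R (\<Lambda> N - \<phi>))"
        using w[OF j] by (cases "j = 1"; cases "j = N") (simp_all add: r_def scaleR_add_right scaleR_diff_right)
      then show "(w j - w j / w i * (1 - of_bool (N = i)) * A j i) *\<^sub>R
          (- G j + (of_bool (j = 1) / w 1) *\<^sub>R (\<mu> - \<Lambda> 1)
                 + (of_bool (j = N) / w N) *\<^sub>R (\<Lambda> N - \<phi>)) =
           r j - ((1 - of_bool (N = i)) / w i) *\<^sub>R (A j i *\<^sub>R r j)"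
        by (simp only: scaleR_scaleR scaleR_diff_left) (simp add: mult_ac)
    qed simp
    also have "\<dots> = (\<Sum>j\<in>{1..N}. r j) -
        ((1 - of_bool (N = i)) / w i) *\<^sub>R (\<Sum>j\<in>{1..N}. A j i *\<^sub>R r j)"
      by (simp only: sum_subtractf scaleR_sum_right)
    also have "(\<Sum>j\<in>{1..N}. A j i *\<^sub>R r j) = (\<Sum>j\<in>{2..N}. A j i *\<^sub>R r j)"
      using first[OF i] N by (subst sum.atLeast_Suc_atMost) (auto simp: numeral_2_eq_2)
    finally show ?thesis .
  qed
  have r_tail: "r j = d j - M (j - 1) + of_bool (j = N) *\<^sub>R \<Lambda> N" if "j \<in> {2..N}" for j
    using that by (auto simp: r_def d_def)
  have Ar: "(\<Sum>j\<in>{2..N}. A j i *\<^sub>R r j) =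
      (\<Sum>j\<in>{2..N}. A j i *\<^sub>R d j) - w i *\<^sub>R \<Lambda> i + w i *\<^sub>R \<Lambda> N" if i: "i \<in> {1..N}" for i
  proof -
    have "(\<Sum>j\<in>{2..N}. A j i *\<^sub>R r j) = (\<Sum>j\<in>{2..N}. A j i *\<^sub>R d j) -
        (\<Sum>j\<in>{2..N}. A j i *\<^sub>R M (j - 1)) + (\<Sum>j\<in>{2..N}. A j i *\<^sub>R of_bool (j = N) *\<^sub>R \<Lambda> N)"
      unfolding sum_subtractf[symmetric] sum.distrib[symmetric]
      by (intro sum.cong) (simp_all add: r_tail scaleR_add_right scaleR_diff_right)
    also have "(\<Sum>j\<in>{2..N}. A j i *\<^sub>R of_bool (j = N) *\<^sub>R \<Lambda> N) = 
       (\<Sum>j\<in>{N}. A j i *\<^sub>R of_bool (j = N) *\<^sub>R \<Lambda> N)"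
      using N by (intro sum.mono_neutral_right) auto
    finally show ?thesis using \<Lambda>[OF i] last[OF i] by simp
  qed
  have shift: "(\<Sum>j\<in>{2..N}. M (j - 1)) = (\<Sum>k\<in>{1..N-1}. M k)"
    by (rule sum.reindex_bij_witness[of _ "\<lambda>k. k + 1" "\<lambda>j. j - 1"]) auto
  have r_sum: "(\<Sum>j\<in>{1..N}. r j) = (\<Sum>j\<in>{2..N}. d j) +
      (\<mu> - (\<Sum>k\<in>{1..N-1}. M k) - w 1 *\<^sub>R G 1) + (\<Lambda> N - \<Lambda> 1)"
  proof -
    have "(\<Sum>j\<in>{1..N}. r j) = r 1 + (\<Sum>j\<in>{2..N}. r j)"
      using N by (subst sum.atLeast_Suc_atMost) (auto simp: numeral_2_eq_2)
    also have "(\<Sum>j\<in>{2..N}. r j) = (\<Sum>j\<in>{2..N}. d j) - (\<Sum>j\<in>{2..N}. M (j - 1)) +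
        (\<Sum>j\<in>{2..N}. of_bool (j = N) *\<^sub>R \<Lambda> N)"
      unfolding sum_subtractf[symmetric] sum.distrib[symmetric]
      by (intro sum.cong) (simp_all add: r_tail)
    also have "(\<Sum>j\<in>{2..N}. of_bool (j = N) *\<^sub>R \<Lambda> N) = (\<Sum>j\<in>{N}. of_bool (j = N) *\<^sub>R \<Lambda> N)"
      using N by (intro sum.mono_neutral_right) auto
    finally show ?thesis unfolding shift using N by (simp add: r_def)
  qed
  have kkt: "?kkt \<longleftrightarrow> \<mu> - (\<Sum>k\<in>{1..N-1}. M k) - w 1 *\<^sub>R G 1 = 0 \<and> (\<forall>j\<in>{2..N}. d j = 0)"
  proof -
    have "{2..N} = (\<lambda>k. k + 1) ` {1..N-1}"
      using N by (simp add: numeral_2_eq_2)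
    then have "(\<forall>j\<in>{2..N}. d j = 0) \<longleftrightarrow> (\<forall>k\<in>{1..N-1}. d (k + 1) = 0)"
      by (simp only: ball_simps)
    moreover have "d (k + 1) = 0 \<longleftrightarrow>
        M k = w (k + 1) *\<^sub>R G (k + 1) + of_bool (k = N - 1) *\<^sub>R \<phi>" if "k \<in> {1..N-1}" for k
    proof -
      have "k + 1 = N \<longleftrightarrow> k = N - 1" using N by auto
      then show ?thesis by (simp add: d_def algebra_simps)
    qed
    ultimately show ?thesis by (simp add: algebra_simps)
  qed
  show ?thesis
  proof
    assume ?kkt
    then have d0: "\<forall>j\<in>{2..N}. d j = 0" and S: "(\<Sum>j\<in>{1..N}. r j) = \<Lambda> N - \<Lambda> 1"
      using r_sum unfolding kkt by simp_all
    show ?costate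
    proof
      fix i assume i: "i \<in> {1..N}"
      have "(1 / w i) *\<^sub>R (\<Sum>j\<in>{2..N}. A j i *\<^sub>R r j) = \<Lambda> N - \<Lambda> i"
        unfolding Ar[OF i] using d0 w[OF i] by (simp add: scaleR_add_right scaleR_diff_right)
      then show "\<Lambda> i = \<Lambda> 1 + (\<Sum>j\<in>{1..N}.
        (w j - w j / w i * (1 - of_bool (N = i)) * A j i) *\<^sub>R
          (- G j + (of_bool (j = 1) / w 1) *\<^sub>R (\<mu> - \<Lambda> 1)
                 + (of_bool (j = N) / w N) *\<^sub>R (\<Lambda> N - \<phi>)))"
        unfolding dagger[OF i] S by (cases "i = N") auto
    qed
  next
    assume c: ?costate
    have c': "\<Lambda> i = \<Lambda> 1 + ((\<Sum>j\<in>{1..N}. r j) -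
        ((1 - of_bool (N = i)) / w i) *\<^sub>R (\<Sum>j\<in>{2..N}. A j i *\<^sub>R r j))" if "i \<in> {1..N}" for i
      using bspec[OF c that] unfolding dagger[OF that] .
    have S: "(\<Sum>j\<in>{1..N}. r j) = \<Lambda> N - \<Lambda> 1"
      using c'[of N] N by simp
    have "(\<Sum>j\<in>{2..N}. A j i *\<^sub>R d j) = 0" if i: "i \<in> {1..N-1}" for i
    proof -
      have i': "i \<in> {1..N}" "N \<noteq> i" using i by auto
      have "(1 / w i) *\<^sub>R (\<Sum>j\<in>{2..N}. A j i *\<^sub>R r j) = \<Lambda> N - \<Lambda> i"
      proof -
        have "\<Lambda> i = \<Lambda> 1 + ((\<Lambda> N - \<Lambda> 1) - (1 / w i) *\<^sub>R (\<Sum>j\<in>{2..N}. A j i *\<^sub>R r j))"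
          using c'[OF i'(1)] i'(2) unfolding S by simp
        moreover have "x = b - a" if "a = e + ((b - e) - x)" for a b e x :: 'v
          using that by simp
        ultimately show ?thesis by blast
      qed
      then show ?thesis
        unfolding Ar[OF i'(1)] using w[OF i'(1)] by (simp add: scaleR_add_right scaleR_diff_right)
    qed
    then have "\<forall>j\<in>{2..N}. d j = 0" by (intro ballI) (rule regular)
    then show ?kkt unfolding kkt using r_sum S by simp
  qed
qed

theorem mainTheorem1:
  fixes N :: nat
    and \<tau> :: "nat \<Rightarrow> real"
    and f :: "(real ^ 'nx) \<times> (real ^ 'nu) \<Rightarrow> real ^ 'nx"
    and \<Phi> :: "real ^ 'nx \<Rightarrow> real"
    and X M \<Lambda> :: "nat \<Rightarrow> real ^ 'nx"
    and U :: "nat \<Rightarrow> real ^ 'nu"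
    and \<mu> :: "real ^ 'nx"
  defines "w \<equiv> lgl_weight N \<tau>"
    and "At \<equiv> integ_mat_tilde N \<tau>"
  assumes "N \<ge> 2"
    and "lgl_points N \<tau>"
    and "f differentiable_on UNIV"
    and "\<Phi> differentiable_on UNIV"
    and "\<And>i. i \<in> {1..N} \<Longrightarrow> \<Lambda> i = inverse (w i) *\<^sub>R (\<Sum>k\<in>{1..N-1}. At k i *\<^sub>R M k)"
  shows
    "(\<mu> = (\<Sum>k\<in>{1..N-1}. M k)
          + mat_gradient (\<lambda>Y. frob_inner {1..N-1} M (mat_prod {1} At (dynamics f Y U))) X 1
      \<and> (\<forall>k\<in>{1..N-1}. M k =
          mat_gradient (\<lambda>Y. frob_inner {1..N-1} M (mat_prod {2..N} At (dynamics f Y U))) X (k + 1)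
          + of_bool (k = N - 1) *\<^sub>R gradient \<Phi> (X N))
      \<and> (\<forall>i\<in>{1..N}. 0 =
          mat_gradient (\<lambda>V. frob_inner {1..N-1} M (mat_prod {1..N} At (dynamics f X V))) U i))
     \<longleftrightarrow>
     ((\<forall>i\<in>{1..N}. \<Lambda> i = \<Lambda> 1 + mat_prod {1..N} (integ_mat_dagger N \<tau>)
          (\<lambda>j. - mat_gradient (\<lambda>Y. frob_inner {1..N} \<Lambda> (dynamics f Y U)) X j
               + (of_bool (j = 1) / w 1) *\<^sub>R (\<mu> - \<Lambda> 1)
               + (of_bool (j = N) / w N) *\<^sub>R (\<Lambda> N - gradient \<Phi> (X N))) i)
      \<and> (\<forall>i\<in>{1..N}. 0 = mat_gradient (\<lambda>V. frob_inner {1..N} \<Lambda> (dynamics f X V)) U i))"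
proof -
  define G where "G i = gradient (\<lambda>x. \<Lambda> i \<bullet> f (x, U i)) (X i)" for i
  define H where "H i = gradient (\<lambda>u. \<Lambda> i \<bullet> f (X i, u)) (U i)" for i
  note lgl = assms(4) and N = assms(3)
  have ends: "\<tau> 1 = -1" "\<tau> N = 1" using lgl by (auto simp: lgl_points_def)
  have w: "w i \<noteq> 0" if "i \<in> {1..N}" for i
    unfolding w_def by (rule lgl_weight_nonzero[OF lgl N that])
  have w\<Lambda>: "w i *\<^sub>R \<Lambda> i = (\<Sum>k\<in>{1..N-1}. At k i *\<^sub>R M k)" if "i \<in> {1..N}" for i
    using assms(7)[OF that] w[OF that] by simp
  have f_at: "f differentiable (at p)" for p
    using assms(5) unfolding differentiable_on_def by blast
  have diff_x: "(\<lambda>x. \<Lambda> i \<bullet> f (x, U i)) differentiable (at x)" for i x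
  proof -
    have "(\<lambda>x. f (x, U i)) differentiable (at x)"
      by (rule differentiable_compose[where f = f, OF f_at])
         (rule differentiableI, rule has_derivative_Pair[OF has_derivative_ident has_derivative_const])
    then show ?thesis by (intro differentiable_inner) auto
  qed
  have diff_u: "(\<lambda>u. \<Lambda> i \<bullet> f (X i, u)) differentiable (at u)" for i u
  proof -
    have "(\<lambda>u. f (X i, u)) differentiable (at u)"
      by (rule differentiable_compose[where f = f, OF f_at])
         (rule differentiableI, rule has_derivative_Pair[OF has_derivative_const has_derivative_ident])
    then show ?thesis by (intro differentiable_inner) auto
  qed
  have inner_M: "frob_inner {1..N-1} M (mat_prod J At (dynamics f Y V)) =
      (\<Sum>j\<in>J. w j * (\<Lambda> j \<bullet> f (Y j, V j)))" if "J \<subseteq> {1..N}" for J Y V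
    unfolding frob_inner_mat_prod dynamics_def
  proof (intro sum.cong refl)
    fix j assume "j \<in> J"
    with that have j: "j \<in> {1..N}" by blast
    show "(\<Sum>k\<in>{1..N-1}. At k j *\<^sub>R M k) \<bullet> f (Y j, V j) = w j * (\<Lambda> j \<bullet> f (Y j, V j))"
      unfolding w\<Lambda>[OF j, symmetric] by (rule inner_scaleR_left)
  qed
  have inner_\<Lambda>: "frob_inner {1..N} \<Lambda> (dynamics f Y V) =
      (\<Sum>j\<in>{1..N}. 1 * (\<Lambda> j \<bullet> f (Y j, V j)))" for Y V
    by (simp add: frob_inner_eq dynamics_def)
  have grad_M_X: "mat_gradient (\<lambda>Y. frob_inner {1..N-1} M (mat_prod J At (dynamics f Y U))) X i =
      w i *\<^sub>R G i" if "i \<in> J" "J \<subseteq> {1..N}" for i J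
    unfolding inner_M[OF that(2)] G_def
    using mat_gradient_separable[where \<phi> = "\<lambda>j x. \<Lambda> j \<bullet> f (x, U j)" and J = J, OF _ that(1) diff_x]
      finite_subset[OF that(2)] by simp
  have grad_M_U: "mat_gradient (\<lambda>V. frob_inner {1..N-1} M (mat_prod {1..N} At (dynamics f X V))) U i =
      w i *\<^sub>R H i" if "i \<in> {1..N}" for i
    unfolding inner_M[OF order_refl] H_def
    using mat_gradient_separable[where \<phi> = "\<lambda>j u. \<Lambda> j \<bullet> f (X j, u)", OF _ that diff_u]
    by simp
  have grad_\<Lambda>_X: "mat_gradient (\<lambda>Y. frob_inner {1..N} \<Lambda> (dynamics f Y U)) X i = G i"
    if "i \<in> {1..N}" for i
    unfolding inner_\<Lambda> G_def
    using mat_gradient_separable[where \<phi> = "\<lambda>j x. \<Lambda> j \<bullet> f (x, U j)" and a = "\<lambda>j. 1", OF _ that diff_x]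
    by simp
  have grad_\<Lambda>_U: "mat_gradient (\<lambda>V. frob_inner {1..N} \<Lambda> (dynamics f X V)) U i = H i"
    if "i \<in> {1..N}" for i
    unfolding inner_\<Lambda> H_def
    using mat_gradient_separable[where \<phi> = "\<lambda>j u. \<Lambda> j \<bullet> f (X j, u)" and a = "\<lambda>j. 1", OF _ that diff_u]
    by simp
  have row_shift: "w i *\<^sub>R \<Lambda> i = (\<Sum>j\<in>{2..N}. integ_mat N \<tau> j i *\<^sub>R M (j - 1))"
    if "i \<in> {1..N}" for i
    unfolding w\<Lambda>[OF that] At_def integ_mat_tilde_def
    by (rule sum.reindex_bij_witness[of _ "\<lambda>j. j - 1" "\<lambda>k. k + 1"]) auto
  have first: "mat_gradient (\<lambda>Y. frob_inner {1..N-1} M (mat_prod {1} At (dynamics f Y U))) X 1 =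
      w 1 *\<^sub>R G 1"
    using N by (intro grad_M_X) auto
  have later: "(\<forall>k\<in>{1..N-1}. M k =
          mat_gradient (\<lambda>Y. frob_inner {1..N-1} M (mat_prod {2..N} At (dynamics f Y U))) X (k + 1)
          + of_bool (k = N - 1) *\<^sub>R gradient \<Phi> (X N)) \<longleftrightarrow>
      (\<forall>k\<in>{1..N-1}. M k = w (k + 1) *\<^sub>R G (k + 1) + of_bool (k = N - 1) *\<^sub>R gradient \<Phi> (X N))"
  proof (intro ball_cong refl)
    fix k assume "k \<in> {1..N-1}"
    then have "k + 1 \<in> {2..N}" "{2..N} \<subseteq> {1..N}" by auto
    from grad_M_X[OF this]
    show "(M k = mat_gradient (\<lambda>Y. frob_inner {1..N-1} M (mat_prod {2..N} At (dynamics f Y U))) X (k + 1)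
          + of_bool (k = N - 1) *\<^sub>R gradient \<Phi> (X N)) \<longleftrightarrow>
        (M k = w (k + 1) *\<^sub>R G (k + 1) + of_bool (k = N - 1) *\<^sub>R gradient \<Phi> (X N))"
      by (simp only:)
  qed
  have dagger: "mat_prod {1..N} (integ_mat_dagger N \<tau>)
          (\<lambda>j. - mat_gradient (\<lambda>Y. frob_inner {1..N} \<Lambda> (dynamics f Y U)) X j
               + (of_bool (j = 1) / w 1) *\<^sub>R (\<mu> - \<Lambda> 1)
               + (of_bool (j = N) / w N) *\<^sub>R (\<Lambda> N - gradient \<Phi> (X N))) i =
      (\<Sum>j\<in>{1..N}. (w j - w j / w i * (1 - of_bool (N = i)) * integ_mat N \<tau> j i) *\<^sub>R
          (- G j + (of_bool (j = 1) / w 1) *\<^sub>R (\<mu> - \<Lambda> 1)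
                 + (of_bool (j = N) / w N) *\<^sub>R (\<Lambda> N - gradient \<Phi> (X N))))" for i
    unfolding mat_prod_def integ_mat_dagger_def w_def[symmetric]
    by (intro sum.cong refl) (simp only: grad_\<Lambda>_X)
  have controls: "(\<forall>i\<in>{1..N}. 0 =
          mat_gradient (\<lambda>V. frob_inner {1..N-1} M (mat_prod {1..N} At (dynamics f X V))) U i) \<longleftrightarrow>
      (\<forall>i\<in>{1..N}. 0 = mat_gradient (\<lambda>V. frob_inner {1..N} \<Lambda> (dynamics f X V)) U i)"
    using w by (intro ball_cong refl) (simp only: grad_M_U grad_\<Lambda>_U, simp)
  have states: "(\<mu> = (\<Sum>k\<in>{1..N-1}. M k) + w 1 *\<^sub>R G 1 \<and>
          (\<forall>k\<in>{1..N-1}. M k = w (k + 1) *\<^sub>R G (k + 1) + of_bool (k = N - 1) *\<^sub>R gradient \<Phi> (X N))) \<longleftrightarrow>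
     (\<forall>i\<in>{1..N}. \<Lambda> i = \<Lambda> 1 + (\<Sum>j\<in>{1..N}.
        (w j - w j / w i * (1 - of_bool (N = i)) * integ_mat N \<tau> j i) *\<^sub>R
          (- G j + (of_bool (j = 1) / w 1) *\<^sub>R (\<mu> - \<Lambda> 1)
                 + (of_bool (j = N) / w N) *\<^sub>R (\<Lambda> N - gradient \<Phi> (X N)))))"
  proof (rule integral_costate_equivalence[OF N w _ _ _ row_shift])
    show "integ_mat N \<tau> 1 i = 0" for i by (rule integ_mat_first_row[of \<tau>, OF ends(1)])
    show "integ_mat N \<tau> N i = w i" for i unfolding w_def by (rule integ_mat_last_row[of \<tau> N, OF ends(2)])
    show "d k = 0" if "\<And>i. i \<in> {1..N-1} \<Longrightarrow> (\<Sum>j\<in>{2..N}. integ_mat N \<tau> j i *\<^sub>R d j) = 0"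
      "k \<in> {2..N}" for d :: "nat \<Rightarrow> real ^ 'nx" and k
      using integ_mat_block_regular[OF lgl N] that by blast
  qed
  show ?thesis
    unfolding controls first later dagger using states by (simp only: conj_assoc[symmetric])
qed

end
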